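(* For every $r,k\in\mathbb{N}$, every $\alpha>0$ and every non-decreasing function $\pi:(0,1]\to(0,1]$ with $\pi(\gamma)\to0$ as $\gamma\to0$ there exists a constant $C=C(r,k,\pi,\alpha)$, depending only on $r,k,\pi,\alpha$, such that the following holds. Let $G$ be a finitely generated group of rank at most $r$, and let $M=(\mu_n)_{n=1}^\infty$ be a sequence of probability measures on $G$ that detects index uniformly at rate $\pi$. Suppose that $\mathrm{dc}_M^k(G)\ge\alpha$. Then $G$ has a $k$-step nilpotent subgroup of index at most $C$.
   Context: Groups are discrete. "$G$ has rank at most $r$" means that $G$ can be generated by at most $r$ elements. A group $H$ is $k$-step nilpotent if all $(k+1)$-fold simple commutators of elements of $H$ are trivial (i.e. nilpotent of class at most $k$). Simple commutators are defined by $[x_1,x_2]=x_1^{-1}x_2^{-1}x_1x_2$ and $[x_1,\ldots,x_k]=[[x_1,\ldots,x_{k-1}],x_k]$. For a probability measure $\mu$ on $G$, $\mathrm{dc}^k_\mu(G)$ is the probability that $[x_1,\ldots,x_{k+1}]=1$ when $x_1,\ldots,x_{k+1}$ are chosen independently according to $\mu$ (i.e. the $(\mu\times\cdots\times\mu)$-measure of the set of such tuples in $G^{k+1}$). For a sequence $M=(\mu_n)_{n=1}^\infty$ of probability measures, $\mathrm{dc}_M^k(G)=\limsup_{n\to\infty}\mathrm{dc}^k_{\mu_n}(G)$. The sequence $M$ detects index uniformly at rate $\pi$ if for every $\varepsilon>0$ there exists $N=N(\varepsilon)\in\mathbb{N}$ such that for every $m\in\mathbb{N}$ and every subgroup $H\le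 G$ with $[G:H]\ge m$ (possibly infinite) we have $\mu_n(H)\le\pi(\frac1m)+\varepsilon$ for every $n\ge N$ (the same $N(\varepsilon)$ works for all $m$ and $H$). *)

theory Defs
  imports "HOL-Algebra.Algebra" "HOL-Probability.Probability" "HOL-Library.Extended_Nat"
begin

definition group_comm :: "('a, 'b) monoid_scheme \<Rightarrow> 'a \<Rightarrow> 'a \<Rightarrow> 'a" where
  "group_comm G x y = inv\<^bsub>G\<^esub> x \<otimes>\<^bsub>G\<^esub> inv\<^bsub>G\<^esub> y \<otimes>\<^bsub>G\<^esub> x \<otimes>\<^bsub>G\<^esub> y"

text \<open>Entries are numbered from 0: \<open>simple_comm G x k\<close> is the \<open>(k + 1)\<close>-fold simple
  commutator of \<open>x 0, \<dots>, x k\<close>.\<close>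

primrec simple_comm :: "('a, 'b) monoid_scheme \<Rightarrow> (nat \<Rightarrow> 'a) \<Rightarrow> nat \<Rightarrow> 'a" where
  "simple_comm G x 0 = x 0"
| "simple_comm G x (Suc k) = group_comm G (simple_comm G x k) (x (Suc k))"

definition step_nilpotent :: "('a, 'b) monoid_scheme \<Rightarrow> nat \<Rightarrow> bool" where
  "step_nilpotent H k \<longleftrightarrow>
     (\<forall>x. (\<forall>i\<le>k. x i \<in> carrier H) \<longrightarrow> simple_comm H x k = \<one>\<^bsub>H\<^esub>)"

definition rank_at_most :: "('a, 'b) monoid_scheme \<Rightarrow> nat \<Rightarrow> bool" where
  "rank_at_most G r \<longleftrightarrow>
     (\<exists>S \<subseteq> carrier G. finite S \<and> card S \<le> r \<and> generate G S = carrier G)"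

definition subgroup_index :: "('a, 'b) monoid_scheme \<Rightarrow> 'a set \<Rightarrow> enat" where
  "subgroup_index G H =
     (if finite (rcosets\<^bsub>G\<^esub> H) then enat (card (rcosets\<^bsub>G\<^esub> H)) else \<infinity>)"

text \<open>Groups are discrete, so every subset is measurable.\<close>

definition prob_measure_on :: "('a, 'b) monoid_scheme \<Rightarrow> 'a measure \<Rightarrow> bool" where
  "prob_measure_on G \<mu> \<longleftrightarrow>
     prob_space \<mu> \<and> space \<mu> = carrier G \<and> sets \<mu> = Pow (carrier G)"

definition dc :: "('a, 'b) monoid_scheme \<Rightarrow> nat \<Rightarrow> 'a measure \<Rightarrow> real" where
  "dc G k \<mu> = measure (\<Pi>\<^sub>M i\<in>{..k}. \<mu>)
     {x \<in> {..k} \<rightarrow>\<^sub>E carrier G. simple_comm G x k = \<one>\<^bsub>G\<^esub>}"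

definition dc_seq :: "('a, 'b) monoid_scheme \<Rightarrow> nat \<Rightarrow> (nat \<Rightarrow> 'a measure) \<Rightarrow> ereal" where
  "dc_seq G k M = limsup (\<lambda>n. ereal (dc G k (M n)))"

definition detects_index_uniformly ::
    "('a, 'b) monoid_scheme \<Rightarrow> (nat \<Rightarrow> 'a measure) \<Rightarrow> (real \<Rightarrow> real) \<Rightarrow> bool" where
  "detects_index_uniformly G M \<pi> \<longleftrightarrow>
     (\<forall>\<epsilon>>0. \<exists>N. \<forall>m\<ge>1. \<forall>H. subgroup H G \<and> enat m \<le> subgroup_index G H \<longrightarrow>
        (\<forall>n\<ge>N. measure (M n) H \<le> \<pi> (1 / real m) + \<epsilon>))"

text \<open>\<open>C\<close> has the property required of the constant, for all groups whose elements are of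
  type \<open>'a\<close>.  HOL cannot quantify over types inside a formula, hence the type argument;
  to state that one \<open>C\<close> serves groups of every type, say that some \<open>C\<close> serves the groups of type
  \<open>nat\<close> and that every such \<open>C\<close> serves the groups of type \<open>'a\<close> for arbitrary \<open>'a\<close>
  (finitely generated groups are countable).\<close>

definition nilpotent_index_bound ::
    "'a itself \<Rightarrow> nat \<Rightarrow> nat \<Rightarrow> (real \<Rightarrow> real) \<Rightarrow> real \<Rightarrow> nat \<Rightarrow> bool" where
  "nilpotent_index_bound (_ :: 'a itself) r k \<pi> \<alpha> C \<longleftrightarrow>
     (\<forall>(G :: 'a monoid) (M :: nat \<Rightarrow> 'a measure).
        group G \<and> rank_at_most G r \<and> (\<forall>n. prob_measure_on G (M n)) \<and>
        detects_index_uniformly G M \<pi> \<and> ereal \<alpha> \<le> dc_seq G k M \<longrightarrow>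
        (\<exists>H. subgroup H G \<and> step_nilpotent (G\<lparr>carrier := H\<rparr>) k \<and>
             subgroup_index G H \<le> enat C))"

end

(* Induct on k, for the probability that the simple commutator of k + 1 entries lies in a normal
   subgroup N of G (working with N instead of passing to G / N).  If that probability is at least
   alpha then with probability at least alpha / 2 the commutator c of the first k entries is such
   that the subgroup of all y with [c,y] in N has measure at least alpha / 2, hence has index at
   most some m.  All these subgroups contain Gamma, the intersection of all subgroups of index at
   most m, whose index is bounded because G has bounded rank.  So c lies in the normal subgroup N'
   of elements commuting with Gamma modulo N; induction gives a subgroup H of bounded index all of
   whose k-fold simple commutators lie in N', and H \<inter> Gamma is the subgroup sought. *)
theory Submission imports Defs begin

section \<open>Subgroups of bounded index\<close>

text \<open>Two elements with the same value under \<open>f\<close> lie in the same right coset, so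
  the value determines the coset and there are at most \<open>card Y\<close> cosets.
  \<open>f\<close> may take several values on one coset, which leaves freedom when a bound is
  wanted.\<close>

lemma (in group) subgroup_index_leI:
  assumes H: "subgroup H G" and fin: "finite Y" and fY: "f \<in> carrier G \<rightarrow> Y"
    and inj: "\<And>x y. x \<in> carrier G \<Longrightarrow> y \<in> carrier G \<Longrightarrow> f x = f y \<Longrightarrow> x \<otimes> inv y \<in> H"
  shows "subgroup_index G H \<le> enat (card Y)"
proof -
  \<comment> \<open>\<open>?g\<close> recovers a coset from a value of \<open>f\<close> through an
    arbitrary preimage of that value.\<close>
  let ?g = "\<lambda>y. H #> inv_into (carrier G) f y"
  have eq: "H #> x = ?g (f x)" if x: "x \<in> carrier G" for x
  proof -
    let ?x = "inv_into (carrier G) f (f x)"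
    have xx: "?x \<in> carrier G" "f ?x = f x"
      using x by (auto simp: inv_into_into f_inv_into_f)
    have "?x \<otimes> inv x \<in> H" using inj[OF xx(1) x xx(2)] .
    hence "?x \<in> H #> x" using subgroup.rcos_module[OF H is_group x xx(1)] by blast
    thus ?thesis using repr_independence[OF _ _ H] x by blast
  qed
  have "rcosets H \<subseteq> ?g ` Y"
  proof
    fix A assume "A \<in> rcosets H"
    then obtain x where "x \<in> carrier G" "A = H #> x" by (auto simp: RCOSETS_def)
    with eq fY show "A \<in> ?g ` Y" by blast
  qed
  hence "finite (rcosets H)" "card (rcosets H) \<le> card Y"
    using fin by (auto intro: finite_subset surj_card_le)
  thus ?thesis by (simp add: subgroup_index_def)
qed

text \<open>Here \<open>d\<close> is the index and \<open>e x\<close> the number of the right coset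
  of \<open>x\<close>. Natural numbers as labels make the coset spaces of different subgroups
  comparable, which the counting of subgroups relies on.\<close>

lemma (in group) subgroup_index_enumerate:
  assumes H: "subgroup H G" and ix: "subgroup_index G H \<le> enat m"
  obtains e :: "'a \<Rightarrow> nat" and d where "d \<le> m" "e ` carrier G = {..<d}"
    "\<And>x y. x \<in> carrier G \<Longrightarrow> y \<in> carrier G \<Longrightarrow> e x = e y \<longleftrightarrow> x \<otimes> inv y \<in> H"
proof -
  have fin: "finite (rcosets H)" and card: "card (rcosets H) \<le> m"
    using ix by (auto simp: subgroup_index_def split: if_splits)
  obtain b where b: "bij_betw b (rcosets H) {0..<card (rcosets H)}"
    using ex_bij_betw_finite_nat[OF fin] by blast
  let ?e = "\<lambda>x. b (H #> x)"
  have "?e ` carrier G = b ` (rcosets H)" by (auto simp: RCOSETS_def)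
  hence 1: "?e ` carrier G = {..<card (rcosets H)}"
    using b by (auto simp: bij_betw_def)
  have 2: "?e x = ?e y \<longleftrightarrow> x \<otimes> inv y \<in> H" if x: "x \<in> carrier G" and y: "y \<in> carrier G" for x y
  proof -
    have "?e x = ?e y \<longleftrightarrow> H #> x = H #> y"
      using b x y by (auto simp: bij_betw_def RCOSETS_def inj_on_def)
    also have "\<dots> \<longleftrightarrow> x \<in> H #> y"
      using repr_independence[OF _ _ H] rcos_self[OF x H] y by metis
    also have "\<dots> \<longleftrightarrow> x \<otimes> inv y \<in> H"
      using subgroup.rcos_module[OF H is_group y x] .
    finally show ?thesis .
  qed
  show thesis using that[OF card 1 2] .
qed

lemma (in group) subgroup_index_carrier: "subgroup_index G (carrier G) \<le> enat 1"
proof -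
  have "subgroup_index G (carrier G) \<le> enat (card {()})"
    by (rule subgroup_index_leI[OF subgroup_self, of _ "\<lambda>_. ()"]) simp_all
  moreover have "card {()} = 1" by simp
  ultimately show ?thesis by (simp only:)
qed

text \<open>The pair of coset labels for \<open>H\<close> and for \<open>K\<close> separates the
  cosets of the intersection.\<close>

lemma (in group) subgroup_index_Int:
  assumes H: "subgroup H G" "subgroup_index G H \<le> enat a"
    and K: "subgroup K G" "subgroup_index G K \<le> enat b"
  shows "subgroup_index G (H \<inter> K) \<le> enat (a * b)"
proof -
  obtain e d where e: "d \<le> a" "e ` carrier G = {..<d}"
    "\<And>x y. x \<in> carrier G \<Longrightarrow> y \<in> carrier G \<Longrightarrow> e x = (e y :: nat) \<longleftrightarrow> x \<otimes> inv y \<in> H"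
    by (rule subgroup_index_enumerate[OF H]) (rule that; assumption)
  obtain e' d' where e': "d' \<le> b" "e' ` carrier G = {..<d'}"
    "\<And>x y. x \<in> carrier G \<Longrightarrow> y \<in> carrier G \<Longrightarrow> e' x = (e' y :: nat) \<longleftrightarrow> x \<otimes> inv y \<in> K"
    by (rule subgroup_index_enumerate[OF K]) (rule that; assumption)
  have "subgroup_index G (H \<inter> K) \<le> enat (card ({..<d} \<times> {..<d'}))"
  proof (rule subgroup_index_leI[OF subgroups_Inter_pair[OF H(1) K(1)]])
    show "(\<lambda>x. (e x, e' x)) \<in> carrier G \<rightarrow> {..<d} \<times> {..<d'}"
      using e(2) e'(2) by blast
  qed (use e(3) e'(3) in simp_all)
  also have "\<dots> \<le> enat (a * b)" using e(1) e'(1) by (simp add: mult_le_mono)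
  finally show ?thesis .
qed

text \<open>\<open>F\<close> has to be non-empty because \<open>\<Inter>{}\<close> is the whole type
  and not the carrier.\<close>

lemma (in group) subgroup_index_Inter:
  assumes fin: "finite F" and ne: "F \<noteq> {}"
    and sub: "\<And>K. K \<in> F \<Longrightarrow> subgroup K G" and ix: "\<And>K. K \<in> F \<Longrightarrow> subgroup_index G K \<le> enat m"
  shows "subgroup (\<Inter>F) G \<and> subgroup_index G (\<Inter>F) \<le> enat (m ^ card F)"
  using fin ne sub ix
proof (induction F rule: finite_ne_induct)
  case (singleton K)
  then show ?case by simp
next
  case (insert K F)
  have IH: "subgroup (\<Inter>F) G" "subgroup_index G (\<Inter>F) \<le> enat (m ^ card F)"
    using insert by blast+
  have K: "subgroup K G" "subgroup_index G K \<le> enat m" using insert.prems by blast+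
  have "m * m ^ card F = m ^ card (insert K F)" using insert.hyps by simp
  thus ?case
    using subgroup_index_Int[OF K IH] subgroups_Inter_pair[OF K(1) IH(1)]
    by (simp only: Inter_insert)
qed

section \<open>Counting the subgroups of bounded index\<close>

text \<open>If the generators move the coset labels of \<open>H\<close> and of \<open>K\<close> in
  the same way, then so does every group element. \<open>H\<close> and \<open>K\<close> are the
  stabilisers of the labels of their trivial cosets, and these labels agree.\<close>

lemma (in group) subgroup_eqI_enumerate:
  assumes S: "S \<subseteq> carrier G" "generate G S = carrier G"
    and H: "subgroup H G" and K: "subgroup K G"
    and e: "\<And>x y. x \<in> carrier G \<Longrightarrow> y \<in> carrier G \<Longrightarrow> e x = e y \<longleftrightarrow> x \<otimes> inv y \<in> H"
    and e': "\<And>x y. x \<in> carrier G \<Longrightarrow> y \<in> carrier G \<Longrightarrow> e' x = e' y \<longleftrightarrow> x \<otimes> inv y \<in> K"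
    and im: "e ` carrier G = e' ` carrier G" and one: "e \<one> = e' \<one>"
    and act: "\<And>s x y. s \<in> S \<Longrightarrow> x \<in> carrier G \<Longrightarrow> y \<in> carrier G \<Longrightarrow> e x = e' y \<Longrightarrow>
      e (x \<otimes> s) = e' (y \<otimes> s)"
  shows "H = K"
proof -
  have key: "\<forall>x\<in>carrier G. \<forall>y\<in>carrier G. e x = e' y \<longrightarrow> e (x \<otimes> g) = e' (y \<otimes> g)"
    if "g \<in> generate G S" for g
    using that
  proof (induction g rule: generate.induct)
    case one then show ?case by simp
  next
    case (incl s) then show ?case using act by blast
  next
    case (inv s)
    hence s: "s \<in> carrier G" using S by blast
    show ?case
    proof (intro ballI impI)
      fix x y assume xy: "x \<in> carrier G" "y \<in> carrier G" "e x = e' y"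
      \<comment> \<open>As the label sets coincide, some coset of \<open>K\<close> carries the label
        of \<open>x \<otimes> inv s\<close>. Multiplying by \<open>s\<close> leads back to the label
        of \<open>y\<close>, so this coset must be that of \<open>y \<otimes> inv s\<close>.\<close>
      obtain z where z: "z \<in> carrier G" "e (x \<otimes> inv s) = e' z"
        using im xy s by (metis imageE imageI inv_closed m_closed)
      have "e (x \<otimes> inv s \<otimes> s) = e' (z \<otimes> s)"
        using act[OF inv _ z(1) z(2)] xy s by simp
      hence "e' y = e' (z \<otimes> s)" using xy s by (simp add: m_assoc)
      hence "y \<otimes> inv (z \<otimes> s) \<in> K" using e' xy z s by simp
      moreover have "y \<otimes> inv (z \<otimes> s) = (y \<otimes> inv s) \<otimes> inv z"
        using xy z s by (simp add: inv_mult_group m_assoc)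
      ultimately have "e' (y \<otimes> inv s) = e' z" using e' xy z s by simp
      thus "e (x \<otimes> inv s) = e' (y \<otimes> inv s)" using z by simp
    qed
  next
    case (eng g h)
    hence gh: "g \<in> carrier G" "h \<in> carrier G" using S by auto
    show ?case
    proof (intro ballI impI)
      fix x y assume xy: "x \<in> carrier G" "y \<in> carrier G" "e x = e' y"
      have "e (x \<otimes> g) = e' (y \<otimes> g)" using eng.IH(1) xy by blast
      hence "e (x \<otimes> g \<otimes> h) = e' (y \<otimes> g \<otimes> h)" using eng.IH(2) xy gh by simp
      thus "e (x \<otimes> (g \<otimes> h)) = e' (y \<otimes> (g \<otimes> h))" using xy gh by (simp add: m_assoc)
    qed
  qed
  have "g \<in> H \<longleftrightarrow> g \<in> K" if g: "g \<in> carrier G" for g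
  proof -
    have "e (\<one> \<otimes> g) = e' (\<one> \<otimes> g)" using key S(2) g one by blast
    hence "e g = e' g" using g by simp
    \<comment> \<open>Membership in either subgroup means having the label of
      \<open>\<one>\<close>.\<close>
    hence "e g = e \<one> \<longleftrightarrow> e' g = e' \<one>" using one by simp
    thus ?thesis using e e' g by simp
  qed
  thus ?thesis using H K by (meson subgroup.mem_carrier subsetI subset_antisym)
qed

text \<open>A subgroup is determined by the action of the generators on its (numbered) cosets and the
  number of the trivial coset.\<close>

lemma (in group) card_subgroups_index_le:
  assumes r: "rank_at_most G r" and m: "m \<ge> 1"
  defines "F \<equiv> {H. subgroup H G \<and> subgroup_index G H \<le> enat m}"
  shows "finite F \<and> card F \<le> Suc m * (m * (m ^ m) ^ r)"
proof -
  obtain S where S: "S \<subseteq> carrier G" "finite S" "card S \<le> r" "generate G S = carrier G"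
    using r unfolding rank_at_most_def by blast
  have "\<forall>H\<in>F. \<exists>ed :: ('a \<Rightarrow> nat) \<times> nat. snd ed \<le> m \<and> fst ed ` carrier G = {..<snd ed} \<and>
     (\<forall>x\<in>carrier G. \<forall>y\<in>carrier G. fst ed x = fst ed y \<longleftrightarrow> x \<otimes> inv y \<in> H)"
  proof
    fix H assume "H \<in> F"
    hence H: "subgroup H G" "subgroup_index G H \<le> enat m" by (simp_all only: F_def mem_Collect_eq)
    obtain e d where "d \<le> m" "e ` carrier G = {..<d}"
       "\<And>x y. x \<in> carrier G \<Longrightarrow> y \<in> carrier G \<Longrightarrow> e x = (e y :: nat) \<longleftrightarrow> x \<otimes> inv y \<in> H"
      by (rule subgroup_index_enumerate[OF H]) (rule that; assumption)
    thus "\<exists>ed :: ('a \<Rightarrow> nat) \<times> nat. snd ed \<le> m \<and> fst ed ` carrier G = {..<snd ed} \<and>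
     (\<forall>x\<in>carrier G. \<forall>y\<in>carrier G. fst ed x = fst ed y \<longleftrightarrow> x \<otimes> inv y \<in> H)"
      by (intro exI[of _ "(e, d)"]) auto
  qed
  from bchoice[OF this] obtain ed :: "'a set \<Rightarrow> ('a \<Rightarrow> nat) \<times> nat" where ed: "\<forall>H\<in>F. snd (ed H) \<le> m \<and>
      fst (ed H) ` carrier G = {..<snd (ed H)} \<and>
      (\<forall>x\<in>carrier G. \<forall>y\<in>carrier G. fst (ed H) x = fst (ed H) y \<longleftrightarrow> x \<otimes> inv y \<in> H)"
    by blast
  define e where "e = (\<lambda>H. fst (ed H))"
  define d where "d = (\<lambda>H. snd (ed H))"
  have d: "d H \<le> m" and im: "e H ` carrier G = {..<d H}" if "H \<in> F" for H
    using ed that by (auto simp: e_def d_def)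
  have e: "e H x = e H y \<longleftrightarrow> x \<otimes> inv y \<in> H" if "H \<in> F" "x \<in> carrier G" "y \<in> carrier G" for H x y
    using ed that by (auto simp: e_def d_def)
  have em: "e H x < m" if "H \<in> F" "x \<in> carrier G" for H x
    using im[OF that(1)] d[OF that(1)] that(2) by (metis imageI lessThan_iff order_less_le_trans)
  define \<phi> where "\<phi> = (\<lambda>H. \<lambda>s\<in>S. \<lambda>i\<in>{..<m}.
      if i < d H then e H (inv_into (carrier G) (e H) i \<otimes> s) else 0)"
  \<comment> \<open>The factors hold the number of cosets, the label of the trivial coset and the
    action of the generators.\<close>
  define D where "D = {..m} \<times> {..<m} \<times> (S \<rightarrow>\<^sub>E ({..<m} \<rightarrow>\<^sub>E {..<m}))"
  have inv_in: "inv_into (carrier G) (e H) i \<in> carrier G" if "H \<in> F" "i < d H" for H i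
    using im[OF that(1)] that(2) by (metis inv_into_into lessThan_iff)
  have \<phi>: "\<phi> H s (e H x) = e H (x \<otimes> s)" if H: "H \<in> F" and s: "s \<in> S" and x: "x \<in> carrier G" for H s x
  proof -
    let ?x = "inv_into (carrier G) (e H) (e H x)"
    have lt: "e H x < d H" using im[OF H] x by blast
    have xx: "?x \<in> carrier G" "e H ?x = e H x"
      using x by (auto simp: inv_into_into f_inv_into_f)
    have sG: "s \<in> carrier G" using s S by blast
    \<comment> \<open>Right multiplication is well defined on right cosets, so the representative
      picked by \<open>inv_into\<close> does not matter.\<close>
    have "(?x \<otimes> s) \<otimes> inv (x \<otimes> s) = ?x \<otimes> (s \<otimes> inv s) \<otimes> inv x"
      using xx(1) x sG by (simp only: inv_mult_group m_assoc m_closed inv_closed)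
    also have "\<dots> = ?x \<otimes> inv x" using xx(1) x sG by simp
    finally have "e H (?x \<otimes> s) = e H (x \<otimes> s)"
      using e[OF H xx(1) x] e[OF H, of "?x \<otimes> s" "x \<otimes> s"] xx x sG by simp
    thus ?thesis using lt em[OF H x] s by (simp add: \<phi>_def)
  qed
  have "inj_on (\<lambda>H. (d H, e H \<one>, \<phi> H)) F"
  proof (rule inj_onI)
    fix H K assume H: "H \<in> F" and K: "K \<in> F"
      and "(d H, e H \<one>, \<phi> H) = (d K, e K \<one>, \<phi> K)"
    hence eq: "d H = d K" "e H \<one> = e K \<one>" "\<phi> H = \<phi> K" by auto
    show "H = K"
    proof (rule subgroup_eqI_enumerate[OF S(1) S(4), where e = "e H" and e' = "e K"])
      show "e H (x \<otimes> s) = e K (y \<otimes> s)"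
        if "s \<in> S" "x \<in> carrier G" "y \<in> carrier G" "e H x = e K y" for s x y
        using \<phi>[OF H that(1,2)] \<phi>[OF K that(1,3)] that(4) eq(3) by simp
    qed (use H K e im eq in \<open>auto simp: F_def\<close>)
  qed
  moreover have "(\<lambda>H. (d H, e H \<one>, \<phi> H)) ` F \<subseteq> D"
  proof (rule image_subsetI)
    fix H assume H: "H \<in> F"
    have "\<phi> H \<in> S \<rightarrow>\<^sub>E ({..<m} \<rightarrow>\<^sub>E {..<m})"
      unfolding \<phi>_def restrict_def
      using S(1) m H by (auto simp: extensional_def PiE_def Pi_def intro!: em inv_in m_closed)
    thus "(d H, e H \<one>, \<phi> H) \<in> D" using d em H by (simp add: D_def)
  qed
  moreover have "finite D" unfolding D_def using S(2) by (intro finite_cartesian_product finite_PiE) auto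
  moreover have "card D \<le> Suc m * (m * (m ^ m) ^ r)"
  proof -
    have "card D = Suc m * (m * (m ^ m) ^ card S)"
      unfolding D_def using S(2) by (simp add: card_cartesian_product card_PiE)
    \<comment> \<open>Replacing \<open>card S\<close> by \<open>r\<close> frees the bound from the
      choice of generators.\<close>
    moreover have "(m ^ m) ^ card S \<le> (m ^ m) ^ r"
      using S(3) m by (intro power_increasing) auto
    ultimately show ?thesis by (simp only: mult_le_mono2)
  qed
  ultimately show ?thesis
    by (meson card_inj_on_le finite_imageD finite_subset order_trans)
qed

section \<open>The intersection of all subgroups of index at most \<open>m\<close>\<close>

definition index_core :: "('a, 'b) monoid_scheme \<Rightarrow> nat \<Rightarrow> 'a set" where
  "index_core G m = \<Inter>{H. subgroup H G \<and> subgroup_index G H \<le> enat m}"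

lemma index_core_subset:
  "subgroup H G \<Longrightarrow> subgroup_index G H \<le> enat m \<Longrightarrow> index_core G m \<subseteq> H"
  by (auto simp: index_core_def)

text \<open>The core is an intersection of finitely many subgroups of index at most
  \<open>m\<close>, and the exponent bounds their number. The bound depends on \<open>m\<close> and
  \<open>r\<close> alone, which keeps the final constant uniform in the group.\<close>

lemma (in group) index_core_bound:
  assumes r: "rank_at_most G r" and m: "m \<ge> 1"
  shows "subgroup (index_core G m) G"
    "subgroup_index G (index_core G m) \<le> enat (m ^ (Suc m * (m * (m ^ m) ^ r)))"
proof -
  let ?F = "{H. subgroup H G \<and> subgroup_index G H \<le> enat m}"
  have F: "finite ?F" "card ?F \<le> Suc m * (m * (m ^ m) ^ r)"
    using card_subgroups_index_le[OF r m] by auto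
  \<comment> \<open>The whole group belongs to the family, so the intersection is over a non-empty
    family.\<close>
  have "subgroup_index G (carrier G) \<le> enat m"
    using subgroup_index_carrier m by (meson enat_ord_simps(1) order_trans)
  hence "carrier G \<in> ?F" using subgroup_self by simp
  hence *: "subgroup (\<Inter>?F) G \<and> subgroup_index G (\<Inter>?F) \<le> enat (m ^ card ?F)"
    by (intro subgroup_index_Inter F) auto
  show "subgroup (index_core G m) G" using * by (simp add: index_core_def)
  have "m ^ card ?F \<le> m ^ (Suc m * (m * (m ^ m) ^ r))"
    using F(2) m by (rule power_increasing)
  thus "subgroup_index G (index_core G m) \<le> enat (m ^ (Suc m * (m * (m ^ m) ^ r)))"
    using * unfolding index_core_def by (meson enat_ord_simps(1) order_trans)
qed

text \<open>Conjugation by \<open>g\<close> permutes the subgroups of index at most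
  \<open>m\<close>: the preimage \<open>?K\<close> of such an \<open>H\<close> is again one, so it
  contains \<open>x\<close>.\<close>

lemma (in group) index_core_conj:
  assumes x: "x \<in> index_core G m" and g: "g \<in> carrier G" and m: "m \<ge> 1"
  shows "g \<otimes> x \<otimes> inv g \<in> index_core G m"
proof -
  have xG: "x \<in> carrier G"
    using x index_core_subset[OF subgroup_self, of m] subgroup_index_carrier m
    by (meson enat_ord_simps(1) order_trans subsetD)
  have "g \<otimes> x \<otimes> inv g \<in> H" if H: "subgroup H G" and ix: "subgroup_index G H \<le> enat m" for H
  proof -
    let ?K = "{y \<in> carrier G. g \<otimes> y \<otimes> inv g \<in> H}"
    have K: "subgroup ?K G"
    proof (rule subgroupI)
      have "g \<otimes> \<one> \<otimes> inv g \<in> H" using g subgroup.one_closed[OF H] by simp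
      thus "?K \<noteq> {}" using one_closed by blast
      fix a b assume a: "a \<in> ?K"
      have "g \<otimes> inv a \<otimes> inv g = inv (g \<otimes> a \<otimes> inv g)"
        using a g by (simp add: inv_mult_group m_assoc)
      thus "inv a \<in> ?K" using a subgroup.m_inv_closed[OF H] by auto
      assume b: "b \<in> ?K"
      have "(g \<otimes> a \<otimes> inv g) \<otimes> (g \<otimes> b \<otimes> inv g) = g \<otimes> a \<otimes> (inv g \<otimes> g) \<otimes> b \<otimes> inv g"
        using a b g by (simp only: m_assoc m_closed inv_closed mem_Collect_eq)
      also have "\<dots> = g \<otimes> (a \<otimes> b) \<otimes> inv g" using a b g by (simp add: m_assoc)
      finally show "a \<otimes> b \<in> ?K" using a b subgroup.m_closed[OF H] by force
    qed auto
    obtain e d where e: "d \<le> m" "e ` carrier G = {..<d}"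
      "\<And>x y. x \<in> carrier G \<Longrightarrow> y \<in> carrier G \<Longrightarrow> e x = (e y :: nat) \<longleftrightarrow> x \<otimes> inv y \<in> H"
      by (rule subgroup_index_enumerate[OF H ix]) (rule that; assumption)
    \<comment> \<open>The label of \<open>g \<otimes> y\<close> with respect to \<open>H\<close>
      separates the right cosets of \<open>?K\<close>, since conjugating
      \<open>a \<otimes> inv b\<close> by \<open>g\<close> gives the quotient of
      \<open>g \<otimes> a\<close> and \<open>g \<otimes> b\<close>.\<close>
    have "subgroup_index G ?K \<le> enat (card {..<d})"
    proof (rule subgroup_index_leI[OF K, where f = "\<lambda>y. e (g \<otimes> y)"])
      fix a b assume ab: "a \<in> carrier G" "b \<in> carrier G" "e (g \<otimes> a) = e (g \<otimes> b)"
      hence "(g \<otimes> a) \<otimes> inv (g \<otimes> b) \<in> H" using e(3) g by simp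
      moreover have "(g \<otimes> a) \<otimes> inv (g \<otimes> b) = g \<otimes> (a \<otimes> inv b) \<otimes> inv g"
        using ab g by (simp add: inv_mult_group m_assoc)
      ultimately show "a \<otimes> inv b \<in> ?K" using ab by simp
    qed (use e g in auto)
    also have "\<dots> \<le> enat m" using e by simp
    finally have "x \<in> ?K" using index_core_subset[OF K] x by blast
    thus ?thesis by simp
  qed
  thus ?thesis by (auto simp: index_core_def)
qed

section \<open>Commutators modulo a normal subgroup\<close>

context group
begin

lemma group_comm_closed [simp, intro]:
  "x \<in> carrier G \<Longrightarrow> y \<in> carrier G \<Longrightarrow> group_comm G x y \<in> carrier G"
  by (simp add: group_comm_def)

lemma simple_comm_closed:
  "(\<And>i. i \<le> k \<Longrightarrow> x i \<in> carrier G) \<Longrightarrow> simple_comm G x k \<in> carrier G"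
  by (induction k) auto

text \<open>This identity makes the condition that \<open>group_comm G x y\<close> lies in a normal
  subgroup multiplicative in \<open>y\<close>.\<close>

lemma group_comm_mult_right:
  assumes "x \<in> carrier G" "y \<in> carrier G" "z \<in> carrier G"
  shows "group_comm G x (y \<otimes> z) = group_comm G x z \<otimes> (inv z \<otimes> group_comm G x y \<otimes> z)"
proof -
  \<comment> \<open>Rebracketing exposes the pairs that cancel, first
    \<open>z \<otimes> inv z\<close> and then \<open>x \<otimes> inv x\<close>.\<close>
  have "group_comm G x z \<otimes> (inv z \<otimes> group_comm G x y \<otimes> z)
      = inv x \<otimes> (inv z \<otimes> (x \<otimes> (z \<otimes> inv z) \<otimes> inv x) \<otimes> inv y) \<otimes> x \<otimes> y \<otimes> z"
    using assms by (simp only: group_comm_def m_assoc m_closed inv_closed)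
  also have "\<dots> = group_comm G x (y \<otimes> z)"
    using assms by (simp add: group_comm_def m_assoc inv_mult_group)
  finally show ?thesis by simp
qed

lemma group_comm_mult_left:
  assumes "x \<in> carrier G" "y \<in> carrier G" "z \<in> carrier G"
  shows "group_comm G (x \<otimes> y) z = inv y \<otimes> group_comm G x z \<otimes> y \<otimes> group_comm G y z"
proof -
  have "inv y \<otimes> group_comm G x z \<otimes> y \<otimes> group_comm G y z
      = inv y \<otimes> inv x \<otimes> inv z \<otimes> x \<otimes> (z \<otimes> (y \<otimes> inv y) \<otimes> inv z) \<otimes> y \<otimes> z"
    using assms by (simp only: group_comm_def m_assoc m_closed inv_closed)
  also have "\<dots> = group_comm G (x \<otimes> y) z"
    using assms by (simp add: group_comm_def m_assoc inv_mult_group)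
  finally show ?thesis by simp
qed

lemma group_comm_one: "x \<in> carrier G \<Longrightarrow> group_comm G x \<one> = \<one>"
  "x \<in> carrier G \<Longrightarrow> group_comm G \<one> x = \<one>"
  by (simp_all add: group_comm_def)

lemma conj_cancel:
  assumes "N \<lhd> G" "x \<in> carrier G" "y \<in> carrier G" "inv y \<otimes> x \<otimes> y \<in> N"
  shows "x \<in> N"
proof -
  have "y \<otimes> (inv y \<otimes> x \<otimes> y) \<otimes> inv y \<in> N" using normal.inv_op_closed2[OF assms(1,3,4)] .
  moreover have "y \<otimes> (inv y \<otimes> x \<otimes> y) \<otimes> inv y = (y \<otimes> inv y) \<otimes> x \<otimes> (y \<otimes> inv y)"
    using assms(2,3) by (simp only: m_assoc m_closed inv_closed)
  ultimately show ?thesis using assms(2,3) by simp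
qed

text \<open>Modulo \<open>N\<close> this set is the centraliser of \<open>c\<close>. Commutator
  identities and normality of \<open>N\<close> replace the passage to the quotient group.\<close>

lemma subgroup_comm_mem:
  assumes N: "N \<lhd> G" and c: "c \<in> carrier G"
  shows "subgroup {y \<in> carrier G. group_comm G c y \<in> N} G"
proof (rule subgroupI)
  note sub = normal_imp_subgroup[OF N]
  let ?K = "{y \<in> carrier G. group_comm G c y \<in> N}"
  have "\<one> \<in> ?K" using c subgroup.one_closed[OF sub] by (simp add: group_comm_one)
  thus "?K \<noteq> {}" by blast
  fix a b assume a: "a \<in> ?K"
  \<comment> \<open>Expanding this trivial commutator expresses the commutator with
    \<open>inv a\<close> as the inverse of a conjugate of the one with \<open>a\<close>.\<close>
  have "\<one> = group_comm G c (a \<otimes> inv a)" using a c by (simp add: group_comm_one)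
  also have "\<dots> = group_comm G c (inv a) \<otimes> (inv (inv a) \<otimes> group_comm G c a \<otimes> inv a)"
    using a c by (intro group_comm_mult_right) auto
  finally have "group_comm G c (inv a) = inv (inv (inv a) \<otimes> group_comm G c a \<otimes> inv a)"
    using a c by (intro inv_equality[symmetric]) auto
  moreover have "inv (inv a) \<otimes> group_comm G c a \<otimes> inv a \<in> N"
    using normal.inv_op_closed1[OF N, of "inv a" "group_comm G c a"] a by auto
  ultimately show "inv a \<in> ?K" using a subgroup.m_inv_closed[OF sub] by auto
  assume b: "b \<in> ?K"
  have "inv b \<otimes> group_comm G c a \<otimes> b \<in> N"
    using normal.inv_op_closed1[OF N, of b "group_comm G c a"] a b by auto
  hence "group_comm G c (a \<otimes> b) \<in> N"
    using group_comm_mult_right[of c a b] a b c subgroup.m_closed[OF sub] by auto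
  thus "a \<otimes> b \<in> ?K" using a b by simp
qed auto

text \<open>The preimage in \<open>G\<close> of the centraliser of the image of \<open>\<Gamma>\<close> in the quotient by \<open>N\<close>.\<close>

definition rel_centraliser :: "'a set \<Rightarrow> 'a set \<Rightarrow> 'a set" where
  "rel_centraliser \<Gamma> N = {c \<in> carrier G. \<forall>g\<in>\<Gamma>. group_comm G c g \<in> N}"

text \<open>Modulo \<open>N\<close> this is the fact that the centraliser of a conjugation-invariant
  set is normal.\<close>

lemma normal_rel_centraliser:
  assumes N: "N \<lhd> G" and \<Gamma>: "\<Gamma> \<subseteq> carrier G"
    and conj: "\<And>x g. x \<in> \<Gamma> \<Longrightarrow> g \<in> carrier G \<Longrightarrow> g \<otimes> x \<otimes> inv g \<in> \<Gamma>"
  shows "rel_centraliser \<Gamma> N \<lhd> G"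
proof -
  note sub = normal_imp_subgroup[OF N]
  \<comment> \<open>Expanding the trivial commutator of \<open>inv a \<otimes> a\<close> with
    \<open>g\<close> puts a conjugate of the wanted commutator into \<open>N\<close>; normality
    removes the conjugation.\<close>
  have comm_inv: "group_comm G (inv a) g \<in> N"
    if "a \<in> carrier G" "g \<in> carrier G" "group_comm G a g \<in> N" for a g
  proof -
    have "\<one> = group_comm G (inv a \<otimes> a) g" using that by (simp add: group_comm_one)
    also have "\<dots> = inv a \<otimes> group_comm G (inv a) g \<otimes> a \<otimes> group_comm G a g"
      using that by (intro group_comm_mult_left) auto
    finally have "inv a \<otimes> group_comm G (inv a) g \<otimes> a = inv (group_comm G a g)"
      using that by (intro inv_equality[symmetric]) auto
    hence *: "inv a \<otimes> group_comm G (inv a) g \<otimes> a \<in> N"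
      using that subgroup.m_inv_closed[OF sub] by simp
    show ?thesis by (rule conj_cancel[OF N _ that(1) *]) (use that in auto)
  qed
  show ?thesis
    unfolding normal_inv_iff
  proof (intro conjI ballI)
    show "subgroup (rel_centraliser \<Gamma> N) G"
    proof (rule subgroupI)
      have "\<one> \<in> rel_centraliser \<Gamma> N"
        using \<Gamma> subgroup.one_closed[OF sub] by (auto simp: rel_centraliser_def group_comm_one)
      thus "rel_centraliser \<Gamma> N \<noteq> {}" by blast
      fix a b assume a: "a \<in> rel_centraliser \<Gamma> N"
      show "inv a \<in> rel_centraliser \<Gamma> N"
        using a \<Gamma> comm_inv by (auto simp: rel_centraliser_def)
      assume b: "b \<in> rel_centraliser \<Gamma> N"
      have "group_comm G (a \<otimes> b) g \<in> N" if g: "g \<in> \<Gamma>" for g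
      proof -
        have "inv b \<otimes> group_comm G a g \<otimes> b \<in> N"
          using normal.inv_op_closed1[OF N, of b "group_comm G a g"] a b g
          by (auto simp: rel_centraliser_def)
        moreover have "group_comm G b g \<in> N" using b g by (auto simp: rel_centraliser_def)
        moreover have "group_comm G (a \<otimes> b) g
            = inv b \<otimes> group_comm G a g \<otimes> b \<otimes> group_comm G b g"
          using a b g \<Gamma> by (intro group_comm_mult_left) (auto simp: rel_centraliser_def)
        ultimately show ?thesis using subgroup.m_closed[OF sub] by simp
      qed
      thus "a \<otimes> b \<in> rel_centraliser \<Gamma> N" using a b by (simp add: rel_centraliser_def)
    qed (auto simp: rel_centraliser_def)
    fix x h assume x: "x \<in> carrier G" and h: "h \<in> rel_centraliser \<Gamma> N"
    have hG: "h \<in> carrier G" using h by (simp add: rel_centraliser_def)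
    have "group_comm G (x \<otimes> h \<otimes> inv x) g \<in> N" if g: "g \<in> \<Gamma>" for g
    proof -
      have gG: "g \<in> carrier G" using g \<Gamma> by blast
      \<comment> \<open>The commutator of \<open>x \<otimes> h \<otimes> inv x\<close> with
        \<open>g\<close> is the conjugate by \<open>x\<close> of the commutator of \<open>h\<close>
        with \<open>inv x \<otimes> g \<otimes> x\<close>, and the latter entry stays in
        \<Gamma>.\<close>
      have "inv x \<otimes> g \<otimes> inv (inv x) \<in> \<Gamma>" using conj[OF g] x by blast
      hence "inv x \<otimes> g \<otimes> x \<in> \<Gamma>" using x by simp
      hence "group_comm G h (inv x \<otimes> g \<otimes> x) \<in> N" using h by (simp add: rel_centraliser_def)
      hence "x \<otimes> group_comm G h (inv x \<otimes> g \<otimes> x) \<otimes> inv x \<in> N"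
        using normal.inv_op_closed2[OF N x] by blast
      moreover have "x \<otimes> group_comm G h (inv x \<otimes> g \<otimes> x) \<otimes> inv x
          = x \<otimes> inv h \<otimes> inv x \<otimes> inv g \<otimes> x \<otimes> h \<otimes> inv x \<otimes> g \<otimes> (x \<otimes> inv x)"
        using x hG gG by (simp add: group_comm_def inv_mult_group m_assoc)
      moreover have "x \<otimes> inv h \<otimes> inv x \<otimes> inv g \<otimes> x \<otimes> h \<otimes> inv x \<otimes> g \<otimes> (x \<otimes> inv x)
          = group_comm G (x \<otimes> h \<otimes> inv x) g"
        using x hG gG by (simp add: group_comm_def inv_mult_group m_assoc)
      ultimately show ?thesis by simp
    qed
    thus "x \<otimes> h \<otimes> inv x \<in> rel_centraliser \<Gamma> N" using x hG by (simp add: rel_centraliser_def)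
  qed
qed

end

lemma simple_comm_cong:
  "(\<And>i. i \<le> k \<Longrightarrow> x i = y i) \<Longrightarrow> simple_comm G x k = simple_comm G y k"
  by (induction k) auto

text \<open>The inverse depends on the carrier of the structure, so commutators formed inside
  \<open>H\<close> must be identified with those formed in \<open>G\<close>.\<close>

lemma (in group) simple_comm_subgroup:
  assumes H: "subgroup H G" and x: "\<And>i. i \<le> k \<Longrightarrow> x i \<in> H"
  shows "simple_comm (G\<lparr>carrier := H\<rparr>) x k = simple_comm G x k \<and> simple_comm G x k \<in> H"
  using x
proof (induction k)
  case (Suc k)
  hence IH: "simple_comm (G\<lparr>carrier := H\<rparr>) x k = simple_comm G x k" "simple_comm G x k \<in> H"
    by auto
  have "x (Suc k) \<in> H" using Suc by simp
  thus ?case using IH H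
    by (auto simp: group_comm_def m_inv_consistent intro!: subgroup.m_closed subgroup.m_inv_closed)
qed auto

section \<open>The distribution of a simple commutator\<close>

text \<open>Generalises \<open>dc\<close> from the trivial subgroup to an arbitrary set
  \<open>N\<close>; for normal \<open>N\<close> it stands for the probability of a trivial
  commutator in the quotient. The induction varies \<open>N\<close> and keeps the group and the
  measures.\<close>

definition comm_prob :: "('a, 'b) monoid_scheme \<Rightarrow> nat \<Rightarrow> 'a measure \<Rightarrow> 'a set \<Rightarrow> real" where
  "comm_prob G k \<mu> N = measure (\<Pi>\<^sub>M i\<in>{..k}. \<mu>) {x \<in> {..k} \<rightarrow>\<^sub>E carrier G. simple_comm G x k \<in> N}"

lemma dc_eq_comm_prob: "dc G k \<mu> = comm_prob G k \<mu> {\<one>\<^bsub>G\<^esub>}"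
  by (simp add: dc_def comm_prob_def)

text \<open>Singletons are finite products of singletons, hence measurable, and every set of tuples
  is a countable union of them. Thus all events about commutators are measurable.\<close>

lemma sets_PiM_countable:
  assumes fin: "finite I" and c: "countable A" and s: "sets \<mu> = Pow A"
  shows "sets (\<Pi>\<^sub>M i\<in>I. \<mu>) = Pow (I \<rightarrow>\<^sub>E A)"
proof -
  have sp: "space \<mu> = A"
    using s sets.top[of \<mu>] sets.sets_into_space[of A \<mu>] by auto
  have "Z \<in> sets (\<Pi>\<^sub>M i\<in>I. \<mu>)" if Z: "Z \<subseteq> (I \<rightarrow>\<^sub>E A)" for Z
  proof (rule sets.countable)
    show "countable Z" using Z countable_PiE[OF fin c] by (rule countable_subset)
    fix x assume "x \<in> Z"
    hence x: "x \<in> (I \<rightarrow>\<^sub>E A)" using Z by blast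
    have "x \<in> extensional I" using x by (simp add: PiE_def)
    hence "{x} = (\<Pi>\<^sub>E i\<in>I. {x i})" by (rule PiE_singleton[symmetric])
    also have "\<dots> \<in> sets (\<Pi>\<^sub>M i\<in>I. \<mu>)"
      using x s by (intro sets_PiM_I_finite fin) auto
    finally show "{x} \<in> sets (\<Pi>\<^sub>M i\<in>I. \<mu>)" .
  qed
  moreover have "sets (\<Pi>\<^sub>M i\<in>I. \<mu>) \<subseteq> Pow (I \<rightarrow>\<^sub>E A)"
    using sets.space_closed[of "\<Pi>\<^sub>M i\<in>I. \<mu>"] by (simp add: space_PiM sp)
  ultimately show ?thesis by blast
qed

lemma comm_prob_0:
  assumes \<mu>: "prob_measure_on G \<mu>" and N: "N \<subseteq> carrier G"
  shows "comm_prob G 0 \<mu> N = measure \<mu> N"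
proof -
  interpret prob_space \<mu> using \<mu> by (simp add: prob_measure_on_def)
  interpret product_prob_space "\<lambda>_. \<mu>" "{0::nat}" by standard
  have "{x \<in> {..0} \<rightarrow>\<^sub>E carrier G. simple_comm G x 0 \<in> N} = (\<Pi>\<^sub>E i\<in>{0::nat}. N)"
    using N by (auto simp: PiE_def)
  thus ?thesis
    using measure_PiM_emb[of "{0}" "\<lambda>_. N"] \<mu> N
    by (simp add: comm_prob_def prob_measure_on_def prod_emb_id)
qed

text \<open>Conditioning on all entries but the last one.\<close>

lemma comm_prob_Suc_le:
  assumes \<mu>: "prob_measure_on G \<mu>" and G: "group G" and c: "countable (carrier G)"
    and \<delta>: "\<delta> \<ge> 0"
    and le: "\<And>c. c \<in> carrier G \<Longrightarrow> c \<notin> N' \<Longrightarrow>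
      measure \<mu> {y \<in> carrier G. group_comm G c y \<in> N} \<le> \<delta>"
  shows "comm_prob G (Suc k) \<mu> N \<le> comm_prob G k \<mu> N' + \<delta>"
proof -
  interpret group G by fact
  interpret \<mu>: prob_space \<mu> using \<mu> by (simp add: prob_measure_on_def)
  have sp: "space \<mu> = carrier G" and st: "sets \<mu> = Pow (carrier G)"
    using \<mu> by (auto simp: prob_measure_on_def)
  interpret P: product_prob_space "\<lambda>_::nat. \<mu>" "I" for I by standard
  let ?P = "\<lambda>k. \<Pi>\<^sub>M i\<in>{..k::nat}. \<mu>"
  let ?X = "{x \<in> {..Suc k} \<rightarrow>\<^sub>E carrier G. simple_comm G x (Suc k) \<in> N}"
  let ?Y = "{x \<in> {..k} \<rightarrow>\<^sub>E carrier G. simple_comm G x k \<in> N'}"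
  have setsP: "sets (?P k) = Pow ({..k} \<rightarrow>\<^sub>E carrier G)" for k
    by (rule sets_PiM_countable[OF _ c st]) simp
  have atMost: "{..Suc k} = insert (Suc k) {..k}" by auto
  have "emeasure (?P (Suc k)) ?X = (\<integral>\<^sup>+x. indicator ?X x \<partial>?P (Suc k))"
    by (rule nn_integral_indicator[symmetric]) (auto simp: setsP)
  \<comment> \<open>Fubini: the last entry is integrated first, with the other entries
    fixed.\<close>
  also have "\<dots> = (\<integral>\<^sup>+x. \<integral>\<^sup>+y. indicator ?X (x(Suc k := y)) \<partial>\<mu> \<partial>?P k)"
    unfolding atMost
    by (rule P.product_nn_integral_insert) (auto simp: setsP atMost[symmetric] intro!: borel_measurable_indicator)
  also have "\<dots> \<le> (\<integral>\<^sup>+x. indicator ?Y x + ennreal \<delta> \<partial>?P k)"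
  proof (rule nn_integral_mono)
    fix x assume "x \<in> space (?P k)"
    hence x: "x \<in> ({..k} \<rightarrow>\<^sub>E carrier G)" by (simp add: space_PiM sp)
    let ?c = "simple_comm G x k"
    have cG: "?c \<in> carrier G" using x by (intro simple_comm_closed) auto
    let ?Z = "{y \<in> carrier G. group_comm G ?c y \<in> N}"
    have "(\<integral>\<^sup>+y. indicator ?X (x(Suc k := y)) \<partial>\<mu>) = (\<integral>\<^sup>+y. indicator ?Z y \<partial>\<mu>)"
    proof (rule nn_integral_cong)
      fix y assume "y \<in> space \<mu>"
      hence y: "y \<in> carrier G" by (simp add: sp)
      have "x(Suc k := y) \<in> ({..Suc k} \<rightarrow>\<^sub>E carrier G)"
        unfolding atMost using x y by (intro PiE_fun_upd) auto
      moreover have "simple_comm G (x(Suc k := y)) k = ?c" by (rule simple_comm_cong) auto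
      ultimately show "(indicator ?X (x(Suc k := y)) :: ennreal) = indicator ?Z y"
        using y by (simp add: indicator_def)
    qed
    also have "\<dots> = emeasure \<mu> ?Z" by (rule nn_integral_indicator) (auto simp: st)
    also have "\<dots> \<le> indicator ?Y x + ennreal \<delta>"
    \<comment> \<open>The inner probability is at most 1 if the commutator of the fixed entries lies
      in \<open>N'\<close>, and at most \<delta> otherwise.\<close>
    proof (cases "?c \<in> N'")
      case True
      have "emeasure \<mu> ?Z \<le> 1" by (rule \<mu>.measure_le_1)
      thus ?thesis using True x by (simp add: add_increasing2)
    next
      case False
      thus ?thesis using le[OF cG False] \<delta>
        by (simp add: \<mu>.emeasure_eq_measure ennreal_leI)
    qed
    finally show "(\<integral>\<^sup>+y. indicator ?X (x(Suc k := y)) \<partial>\<mu>) \<le> indicator ?Y x + ennreal \<delta>" .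
  qed
  also have "\<dots> = emeasure (?P k) ?Y + ennreal \<delta>"
  proof -
    have "?Y \<in> sets (?P k)" by (auto simp: setsP)
    thus ?thesis
      by (subst nn_integral_add) (auto simp: P.emeasure_space_1)
  qed
  finally have "ennreal (comm_prob G (Suc k) \<mu> N) \<le> ennreal (comm_prob G k \<mu> N' + \<delta>)"
    using \<delta> by (simp add: comm_prob_def P.emeasure_eq_measure)
  moreover have "0 \<le> comm_prob G k \<mu> N' + \<delta>" using \<delta> by (simp add: comm_prob_def)
  ultimately show ?thesis by (simp only: ennreal_le_iff)
qed

section \<open>Bounded index\<close>

text \<open>Every element is a finite word in the generators and their inverses, and there are
  countably many such words over a finite alphabet.\<close>

lemma (in group) countable_carrier:
  assumes "rank_at_most G r"
  shows "countable (carrier G)"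
proof -
  obtain S where S: "S \<subseteq> carrier G" "finite S" "generate G S = carrier G"
    using assms unfolding rank_at_most_def by blast
  let ?L = "lists (S \<union> (\<lambda>s. inv s) ` S)"
  let ?f = "\<lambda>l. foldr (\<otimes>) l \<one>"
  have closed: "?f l \<in> carrier G" if "l \<in> ?L" for l
    using that S(1) by (induction l) auto
  have app: "?f (l @ l') = ?f l \<otimes> ?f l'" if "l \<in> ?L" "l' \<in> ?L" for l l'
    using that
  proof (induction l)
    case Nil thus ?case using closed by simp
  next
    case (Cons a l)
    hence "a \<in> carrier G" "?f l \<in> carrier G" "?f l' \<in> carrier G"
      using S(1) closed by auto
    thus ?case using Cons by (simp add: m_assoc)
  qed
  have "g \<in> ?f ` ?L" if "g \<in> generate G S" for g
    using that
  proof (induction g rule: generate.induct)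
    case one
    show ?case by (intro image_eqI[of _ _ "[]"]) auto
  next
    case (incl h)
    thus ?case using S(1) by (intro image_eqI[of _ _ "[h]"]) auto
  next
    case (inv h)
    thus ?case using S(1) by (intro image_eqI[of _ _ "[inv h]"]) auto
  next
    case (eng g h)
    then obtain l l' where l: "l \<in> ?L" "g = ?f l" "l' \<in> ?L" "h = ?f l'" by blast
    hence "g \<otimes> h = ?f (l @ l')" "l @ l' \<in> ?L" using app by auto
    thus ?case by blast
  qed
  hence "carrier G \<subseteq> ?f ` ?L" using S(3) by blast
  moreover have "countable ?L" using S(2) by (intro countable_lists countable_finite) auto
  ultimately show ?thesis by (meson countable_image countable_subset)
qed

text \<open>The contrapositive of index detection, with half of \<delta> spent on the rate and half
  on the error term. The threshold \<open>m\<close> is fixed before the group and the measures, so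
  it depends only on \<pi> and \<delta>.\<close>

lemma detects_index_threshold:
  assumes \<pi>: "(\<pi> \<longlongrightarrow> 0) (at_right (0::real))" and \<delta>: "(\<delta> :: real) > 0"
  obtains m :: nat where "m \<ge> 1"
    "\<And>(G :: ('a, 'b) monoid_scheme) M. detects_index_uniformly G M \<pi> \<Longrightarrow>
      \<forall>\<^sub>F n in sequentially. \<forall>H. subgroup H G \<and> \<delta> \<le> measure (M n) H \<longrightarrow> subgroup_index G H \<le> enat m"
proof -
  \<comment> \<open>The rate is evaluated along the reciprocals of the positive integers, which tend
    to 0 from the right.\<close>
  have "filterlim (\<lambda>n. inverse (real (Suc n))) (at_right 0) sequentially"
    using LIMSEQ_inverse_real_of_nat by (auto simp: filterlim_at)
  hence "((\<lambda>n. \<pi> (inverse (real (Suc n)))) \<longlongrightarrow> 0) sequentially"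
    using filterlim_compose[OF \<pi>] by blast
  hence "\<forall>\<^sub>F n in sequentially. \<pi> (inverse (real (Suc n))) < \<delta> / 2"
    by (rule order_tendstoD) (use \<delta> in simp)
  then obtain n where n: "\<pi> (inverse (real (Suc n))) < \<delta> / 2"
    by (auto simp: eventually_sequentially)
  define m where "m = Suc n"
  have m: "m \<ge> 1" "\<pi> (1 / real m) < \<delta> / 2"
    using n by (auto simp: m_def inverse_eq_divide)
  have "\<forall>\<^sub>F n in sequentially. \<forall>H. subgroup H G \<and> \<delta> \<le> measure (M n) H \<longrightarrow> subgroup_index G H \<le> enat m"
    if det: "detects_index_uniformly G M \<pi>" for G :: "('a, 'b) monoid_scheme" and M
  proof -
    have "\<delta> / 2 > 0" using \<delta> by simp
    then obtain N where N: "\<forall>m\<ge>1. \<forall>H. subgroup H G \<and> enat m \<le> subgroup_index G H \<longrightarrow>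
        (\<forall>n\<ge>N. measure (M n) H \<le> \<pi> (1 / real m) + \<delta> / 2)"
      using det unfolding detects_index_uniformly_def by blast
    have "subgroup_index G H \<le> enat m"
      if H: "subgroup H G" "\<delta> \<le> measure (M n) H" and n: "n \<ge> N" for n H
    proof (rule ccontr)
      assume "\<not> ?thesis"
      hence "enat m \<le> subgroup_index G H" by simp
      hence "measure (M n) H \<le> \<pi> (1 / real m) + \<delta> / 2" using N m(1) H(1) n by blast
      thus False using m(2) H(2) by simp
    qed
    thus ?thesis unfolding eventually_sequentially by blast
  qed
  thus thesis using that[OF m(1)] by blast
qed

text \<open>\<open>C\<close> is chosen before \<open>G\<close>, \<open>M\<close> and
  \<open>N\<close>, so that the induction hypothesis applies to a larger normal subgroup. \<alpha>
  varies because each step halves it. The bound is assumed for infinitely many \<open>n\<close>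
  only, which is what a limsup provides.\<close>

lemma comm_prob_imp_index_bound:
  assumes \<alpha>: "\<alpha> > 0" and \<pi>: "(\<pi> \<longlongrightarrow> 0) (at_right (0::real))"
  shows "\<exists>C. \<forall>(G :: ('a, 'b) monoid_scheme) M N.
     group G \<and> rank_at_most G r \<and> (\<forall>n. prob_measure_on G (M n)) \<and>
     detects_index_uniformly G M \<pi> \<and> N \<lhd> G \<and>
     (\<exists>\<^sub>F n in sequentially. \<alpha> \<le> comm_prob G k (M n) N) \<longrightarrow>
     (\<exists>H. subgroup H G \<and> (\<forall>x. (\<forall>i\<le>k. x i \<in> H) \<longrightarrow> simple_comm G x k \<in> N) \<and>
       subgroup_index G H \<le> enat C)"
  using \<alpha>
proof (induction k arbitrary: \<alpha>)
  case 0
  obtain m :: nat where m: "m \<ge> 1"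
    "\<And>(G :: ('a, 'b) monoid_scheme) M. detects_index_uniformly G M \<pi> \<Longrightarrow>
      \<forall>\<^sub>F n in sequentially. \<forall>H. subgroup H G \<and> \<alpha> \<le> measure (M n) H \<longrightarrow> subgroup_index G H \<le> enat m"
    by (rule detects_index_threshold[OF \<pi> 0]) (rule that; assumption)
  show ?case
  proof (intro exI[of _ m] allI impI, elim conjE)
    fix G :: "('a, 'b) monoid_scheme" and M N
    assume G: "group G" "\<forall>n. prob_measure_on G (M n)" "detects_index_uniformly G M \<pi>" "N \<lhd> G"
      and fr: "\<exists>\<^sub>F n in sequentially. \<alpha> \<le> comm_prob G 0 (M n) N"
    have N: "subgroup N G" using G(4) by (rule normal_imp_subgroup)
    obtain n where n: "\<alpha> \<le> comm_prob G 0 (M n) N"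
      "\<forall>H. subgroup H G \<and> \<alpha> \<le> measure (M n) H \<longrightarrow> subgroup_index G H \<le> enat m"
      \<comment> \<open>One \<open>n\<close> that is both good for the probability and past the
        threshold suffices, and \<open>N\<close> itself is then the subgroup sought.\<close>
      using frequently_ex[OF frequently_eventually_frequently[OF fr m(2)[OF G(3)]]] by blast
    have "comm_prob G 0 (M n) N = measure (M n) N"
      using G(2) subgroup.subset[OF N] by (intro comm_prob_0) auto
    hence "subgroup_index G N \<le> enat m" using n N by simp
    thus "\<exists>H. subgroup H G \<and> (\<forall>x. (\<forall>i\<le>0. x i \<in> H) \<longrightarrow> simple_comm G x 0 \<in> N) \<and>
       subgroup_index G H \<le> enat m"
      using N by (intro exI[of _ N]) simp
  qed
next
  case (Suc k)
  have \<alpha>2: "\<alpha> / 2 > 0" using Suc.prems by simp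
  obtain m :: nat where m: "m \<ge> 1"
    "\<And>(G :: ('a, 'b) monoid_scheme) M. detects_index_uniformly G M \<pi> \<Longrightarrow>
      \<forall>\<^sub>F n in sequentially. \<forall>H. subgroup H G \<and> \<alpha> / 2 \<le> measure (M n) H \<longrightarrow> subgroup_index G H \<le> enat m"
    by (rule detects_index_threshold[OF \<pi> \<alpha>2]) (rule that; assumption)
  obtain C where C: "\<And>(G :: ('a, 'b) monoid_scheme) M N.
     group G \<Longrightarrow> rank_at_most G r \<Longrightarrow> \<forall>n. prob_measure_on G (M n) \<Longrightarrow>
     detects_index_uniformly G M \<pi> \<Longrightarrow> N \<lhd> G \<Longrightarrow>
     \<exists>\<^sub>F n in sequentially. \<alpha> / 2 \<le> comm_prob G k (M n) N \<Longrightarrow>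
     \<exists>H. subgroup H G \<and> (\<forall>x. (\<forall>i\<le>k. x i \<in> H) \<longrightarrow> simple_comm G x k \<in> N) \<and>
       subgroup_index G H \<le> enat C"
    using Suc.IH[OF \<alpha>2] by metis
  \<comment> \<open>The index bound for \<open>index_core G m\<close>; it multiplies the constant of
    the induction hypothesis.\<close>
  let ?D = "m ^ (Suc m * (m * (m ^ m) ^ r))"
  show ?case
  proof (intro exI[of _ "C * ?D"] allI impI, elim conjE)
    fix G :: "('a, 'b) monoid_scheme" and M N
    assume G: "group G" and r: "rank_at_most G r" and M: "\<forall>n. prob_measure_on G (M n)"
      and det: "detects_index_uniformly G M \<pi>" and N: "N \<lhd> G"
      and fr: "\<exists>\<^sub>F n in sequentially. \<alpha> \<le> comm_prob G (Suc k) (M n) N"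
    interpret group G by fact
    let ?\<Gamma> = "index_core G m"
    let ?N' = "rel_centraliser ?\<Gamma> N"
    have \<Gamma>: "subgroup ?\<Gamma> G" "subgroup_index G ?\<Gamma> \<le> enat ?D"
      using index_core_bound[OF r m(1)] by auto
    have N': "?N' \<lhd> G"
      using index_core_conj[OF _ _ m(1)] subgroup.subset[OF \<Gamma>(1)]
      by (intro normal_rel_centraliser[OF N])
    \<comment> \<open>\<open>?N'\<close> is the same for all \<open>n\<close>, so the infinitely
      many good \<open>n\<close> stay good for \<open>?N'\<close>, apart from finitely many.\<close>
    have "\<forall>\<^sub>F n in sequentially. \<alpha> \<le> comm_prob G (Suc k) (M n) N \<longrightarrow> \<alpha> / 2 \<le> comm_prob G k (M n) ?N'"
      using m(2)[OF det]
    proof eventually_elim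
      case (elim n)
      have "comm_prob G (Suc k) (M n) N \<le> comm_prob G k (M n) ?N' + \<alpha> / 2"
      proof (rule comm_prob_Suc_le)
        fix c assume c: "c \<in> carrier G" "c \<notin> ?N'"
        let ?K = "{y \<in> carrier G. group_comm G c y \<in> N}"
        have K: "subgroup ?K G" by (rule subgroup_comm_mem[OF N c(1)])
        show "measure (M n) ?K \<le> \<alpha> / 2"
        proof (rule ccontr)
          \<comment> \<open>A large measure forces index at most \<open>m\<close>, so
            \<open>?K\<close> contains the core and \<open>c\<close> lies in \<open>?N'\<close>,
            contrary to its choice.\<close>
          assume "\<not> ?thesis"
          hence "subgroup_index G ?K \<le> enat m" using elim K by simp
          hence "?\<Gamma> \<subseteq> ?K" by (rule index_core_subset[OF K])
          thus False using c by (auto simp: rel_centraliser_def)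
        qed
      qed (use M G countable_carrier[OF r] \<alpha>2 in auto)
      thus ?case by simp
    qed
    hence "\<exists>\<^sub>F n in sequentially. \<alpha> / 2 \<le> comm_prob G k (M n) ?N'"
      using fr by (rule frequently_rev_mp[rotated])
    then obtain H where H: "subgroup H G"
      "\<forall>x. (\<forall>i\<le>k. x i \<in> H) \<longrightarrow> simple_comm G x k \<in> ?N'" "subgroup_index G H \<le> enat C"
      using C[OF G r M det N'] by blast
    \<comment> \<open>Membership in \<open>H\<close> is used for all entries but the last, and
      membership in \<open>?\<Gamma>\<close> for the last one.\<close>
    have "simple_comm G x (Suc k) \<in> N" if x: "\<forall>i\<le>Suc k. x i \<in> H \<inter> ?\<Gamma>" for x
    proof -
      have "simple_comm G x k \<in> ?N'" using H(2) x by simp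
      moreover have "x (Suc k) \<in> ?\<Gamma>" using x by simp
      ultimately show ?thesis by (simp add: rel_centraliser_def)
    qed
    thus "\<exists>H. subgroup H G \<and> (\<forall>x. (\<forall>i\<le>Suc k. x i \<in> H) \<longrightarrow> simple_comm G x (Suc k) \<in> N) \<and>
       subgroup_index G H \<le> enat (C * ?D)"
      using subgroups_Inter_pair[OF H(1) \<Gamma>(1)] subgroup_index_Int[OF H(1,3) \<Gamma>] by blast
  qed
qed

text \<open>The case of the trivial normal subgroup. A limsup of at least \<alpha> need not be
  attained, so the probability is only bounded below by a smaller positive constant, here
  \<open>\<alpha> / 2\<close>, infinitely often.\<close>

lemma nilpotent_index_bound_exists:
  assumes \<alpha>: "\<alpha> > 0" and \<pi>: "(\<pi> \<longlongrightarrow> 0) (at_right (0::real))"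
  shows "\<exists>C. nilpotent_index_bound TYPE('a) r k \<pi> \<alpha> C"
proof -
  have \<alpha>2: "\<alpha> / 2 > 0" using \<alpha> by simp
  obtain C where C: "\<And>(G :: 'a monoid) M N.
     group G \<Longrightarrow> rank_at_most G r \<Longrightarrow> \<forall>n. prob_measure_on G (M n) \<Longrightarrow>
     detects_index_uniformly G M \<pi> \<Longrightarrow> N \<lhd> G \<Longrightarrow>
     \<exists>\<^sub>F n in sequentially. \<alpha> / 2 \<le> comm_prob G k (M n) N \<Longrightarrow>
     \<exists>H. subgroup H G \<and> (\<forall>x. (\<forall>i\<le>k. x i \<in> H) \<longrightarrow> simple_comm G x k \<in> N) \<and>
       subgroup_index G H \<le> enat C"
    using comm_prob_imp_index_bound[OF \<alpha>2 \<pi>, where ?'a = 'a and ?'b = unit and r = r and k = k]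
    by metis
  show ?thesis
    unfolding nilpotent_index_bound_def
  proof (intro exI[of _ C] allI impI, elim conjE)
    fix G :: "'a monoid" and M
    assume G: "group G" "rank_at_most G r" "\<forall>n. prob_measure_on G (M n)"
        "detects_index_uniformly G M \<pi>" and dc: "ereal \<alpha> \<le> dc_seq G k M"
    interpret group G by fact
    have "\<exists>\<^sub>F n in sequentially. \<alpha> / 2 \<le> comm_prob G k (M n) {\<one>\<^bsub>G\<^esub>}"
    proof (rule ccontr)
      assume "\<not> ?thesis"
      hence "\<forall>\<^sub>F n in sequentially. ereal (dc G k (M n)) \<le> ereal (\<alpha> / 2)"
        unfolding not_frequently by eventually_elim (simp add: dc_eq_comm_prob)
      hence "dc_seq G k M \<le> ereal (\<alpha> / 2)" unfolding dc_seq_def by (rule Limsup_bounded)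
      hence "ereal \<alpha> \<le> ereal (\<alpha> / 2)" using dc by (rule order_trans[rotated])
      thus False using \<alpha> by simp
    qed
    then obtain H where H: "subgroup H G"
      "\<forall>x. (\<forall>i\<le>k. x i \<in> H) \<longrightarrow> simple_comm G x k \<in> {\<one>\<^bsub>G\<^esub>}" "subgroup_index G H \<le> enat C"
      using C[OF G one_is_normal] by blast
    have "step_nilpotent (G\<lparr>carrier := H\<rparr>) k"
      using H(2) simple_comm_subgroup[OF H(1)] by (simp add: step_nilpotent_def)
    thus "\<exists>H. subgroup H G \<and> step_nilpotent (G\<lparr>carrier := H\<rparr>) k \<and> subgroup_index G H \<le> enat C"
      using H by blast
  qed
qed

section \<open>Transport along isomorphisms\<close>

lemma (in group_hom) simple_comm_hom:
  assumes "\<And>i. i \<le> k \<Longrightarrow> x i \<in> carrier G"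
  shows "simple_comm H (\<lambda>i. h (x i)) k = h (simple_comm G x k)"
  using assms
proof (induction k)
  case (Suc k)
  hence "simple_comm G x k \<in> carrier G" "x (Suc k) \<in> carrier G"
    by (auto intro!: G.simple_comm_closed)
  thus ?case using Suc by (simp add: group_comm_def)
qed auto

lemma (in group_hom) subgroup_preimage:
  assumes K: "subgroup K H"
  shows "subgroup {x \<in> carrier G. h x \<in> K} G"
proof (rule G.subgroupI)
  have "\<one> \<in> {x \<in> carrier G. h x \<in> K}" using subgroup.one_closed[OF K] by simp
  thus "{x \<in> carrier G. h x \<in> K} \<noteq> {}" by blast
qed (use subgroup.m_closed[OF K] subgroup.m_inv_closed[OF K] in auto)

text \<open>Coset labels are pulled back along \<open>h\<close> for one inequality and along a
  section of \<open>h\<close> for the other.\<close>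

lemma (in group_hom) subgroup_index_preimage:
  assumes K: "subgroup K H" and surj: "h ` carrier G = carrier H"
  shows "subgroup_index G {x \<in> carrier G. h x \<in> K} = subgroup_index H K"
proof -
  let ?P = "{x \<in> carrier G. h x \<in> K}"
  note P = subgroup_preimage[OF K]
  have le: "subgroup_index G ?P \<le> enat m" if ix: "subgroup_index H K \<le> enat m" for m
  proof -
    obtain e d where e: "d \<le> m" "e ` carrier H = {..<d}"
      "\<And>x y. x \<in> carrier H \<Longrightarrow> y \<in> carrier H \<Longrightarrow> e x = (e y :: nat) \<longleftrightarrow> x \<otimes>\<^bsub>H\<^esub> inv\<^bsub>H\<^esub> y \<in> K"
      by (rule H.subgroup_index_enumerate[OF K ix]) (rule that; assumption)
    have "subgroup_index G ?P \<le> enat (card {..<d})"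
    proof (rule G.subgroup_index_leI[OF P, where f = "\<lambda>x. e (h x)"])
      show "(\<lambda>x. e (h x)) \<in> carrier G \<rightarrow> {..<d}"
        using e(2) hom_closed by (intro funcsetI) (metis imageI)
    qed (use e(3) in auto)
    also have "\<dots> \<le> enat m" using e(1) by simp
    finally show ?thesis .
  qed
  have ge: "subgroup_index H K \<le> enat m" if ix: "subgroup_index G ?P \<le> enat m" for m
  proof -
    obtain e d where e: "d \<le> m" "e ` carrier G = {..<d}"
      "\<And>x y. x \<in> carrier G \<Longrightarrow> y \<in> carrier G \<Longrightarrow> e x = (e y :: nat) \<longleftrightarrow> x \<otimes> inv y \<in> ?P"
      by (rule G.subgroup_index_enumerate[OF P ix]) (rule that; assumption)
    let ?g = "inv_into (carrier G) h"
    have g: "?g y \<in> carrier G" "h (?g y) = y" if "y \<in> carrier H" for y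
      using that surj by (metis inv_into_into, metis f_inv_into_f)
    have "subgroup_index H K \<le> enat (card {..<d})"
    proof (rule H.subgroup_index_leI[OF K, where f = "\<lambda>y. e (?g y)"])
      show "(\<lambda>y. e (?g y)) \<in> carrier H \<rightarrow> {..<d}"
        using e(2) g(1) by (intro funcsetI) (metis imageI)
      fix x y assume xy: "x \<in> carrier H" "y \<in> carrier H" "e (?g x) = e (?g y)"
      hence "h (?g x \<otimes> inv (?g y)) \<in> K" using e(3)[of "?g x" "?g y"] g by simp
      thus "x \<otimes>\<^bsub>H\<^esub> inv\<^bsub>H\<^esub> y \<in> K" using xy g by simp
    qed auto
    also have "\<dots> \<le> enat m" using e(1) by simp
    finally show ?thesis .
  qed
  show ?thesis
  \<comment> \<open>Each inequality is trivial if its right side is infinite; otherwise the right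
    side is itself a finite bound to which \<open>le\<close> or \<open>ge\<close> applies.\<close>
  proof (rule antisym)
    show "subgroup_index G ?P \<le> subgroup_index H K"
      by (cases "subgroup_index H K") (use le in auto)
    show "subgroup_index H K \<le> subgroup_index G ?P"
      by (cases "subgroup_index G ?P") (use ge in auto)
  qed
qed

section \<open>Transport of measures and commutator probabilities\<close>

locale group_iso = group_hom G H h for G :: "('a, 'c) monoid_scheme" and H :: "('b, 'd) monoid_scheme" and h +
  assumes bij: "bij_betw h (carrier G) (carrier H)"
begin

text \<open>The image measure under \<open>h\<close>; \<open>count_space\<close> supplies the full
  power set as sigma-algebra, as \<open>prob_measure_on\<close> demands.\<close>

definition push :: "'a measure \<Rightarrow> 'b measure" where
  "push \<mu> = distr \<mu> (count_space (carrier H)) h"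

lemma image_carrier: "h ` carrier G = carrier H"
  using bij by (simp add: bij_betw_def)

lemma h_eq_one_iff:
  "x \<in> carrier G \<Longrightarrow> h x = \<one>\<^bsub>H\<^esub> \<longleftrightarrow> x = \<one>\<^bsub>G\<^esub>"
  using inj_on_eq_iff[OF bij_betw_imp_inj_on[OF bij], of x "\<one>\<^bsub>G\<^esub>"] by simp

lemma h_measurable:
  "prob_measure_on G \<mu> \<Longrightarrow> h \<in> measurable \<mu> (count_space (carrier H))"
  by (rule measurableI) (auto simp: prob_measure_on_def)

lemma prob_measure_on_push:
  assumes "prob_measure_on G \<mu>"
  shows "prob_measure_on H (push \<mu>)"
  using assms prob_space.prob_space_distr[OF _ h_measurable[OF assms]]
  by (simp add: push_def prob_measure_on_def)

lemma measure_push: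
  assumes "prob_measure_on G \<mu>" "K \<subseteq> carrier H"
  shows "measure (push \<mu>) K = measure \<mu> {x \<in> carrier G. h x \<in> K}"
proof -
  have "h -` K \<inter> space \<mu> = {x \<in> carrier G. h x \<in> K}"
    using assms(1) by (auto simp: prob_measure_on_def)
  thus ?thesis
    unfolding push_def using assms by (subst measure_distr[OF h_measurable]) auto
qed

lemma rank_at_most_image:
  assumes "rank_at_most G r"
  shows "rank_at_most H r"
proof -
  obtain S where S: "S \<subseteq> carrier G" "finite S" "card S \<le> r" "generate G S = carrier G"
    using assms unfolding rank_at_most_def by blast
  have "generate H (h ` S) = carrier H"
    using generate_img[OF S(1)] S(4) image_carrier by simp
  moreover have "card (h ` S) \<le> r" using S(2,3) card_image_le by (meson order_trans)
  moreover have "h ` S \<subseteq> carrier H" using S(1) by auto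
  ultimately show ?thesis using S(2) unfolding rank_at_most_def by (intro exI[of _ "h ` S"]) simp
qed

text \<open>A subgroup of \<open>H\<close> and its preimage have the same index and the same
  measure, so the threshold for \<open>G\<close> also serves \<open>H\<close>.\<close>

lemma detects_index_push:
  assumes M: "\<And>n. prob_measure_on G (M n)" and det: "detects_index_uniformly G M \<pi>"
  shows "detects_index_uniformly H (\<lambda>n. push (M n)) \<pi>"
  unfolding detects_index_uniformly_def
proof (intro allI impI)
  fix \<epsilon> :: real assume "\<epsilon> > 0"
  then obtain N where N: "\<forall>m\<ge>1. \<forall>K. subgroup K G \<and> enat m \<le> subgroup_index G K \<longrightarrow>
        (\<forall>n\<ge>N. measure (M n) K \<le> \<pi> (1 / real m) + \<epsilon>)"
    using det unfolding detects_index_uniformly_def by blast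
  have "measure (push (M n)) K \<le> \<pi> (1 / real m) + \<epsilon>"
    if "m \<ge> 1" "subgroup K H" "enat m \<le> subgroup_index H K" "n \<ge> N" for m n K
  proof -
    have "enat m \<le> subgroup_index G {x \<in> carrier G. h x \<in> K}"
      using that subgroup_index_preimage[OF that(2) image_carrier] by simp
    hence "measure (M n) {x \<in> carrier G. h x \<in> K} \<le> \<pi> (1 / real m) + \<epsilon>"
      using N that subgroup_preimage[OF that(2)] by blast
    thus ?thesis using measure_push[OF M subgroup.subset[OF that(2)]] by simp
  qed
  thus "\<exists>N. \<forall>m\<ge>1. \<forall>K. subgroup K H \<and> enat m \<le> subgroup_index H K \<longrightarrow>
      (\<forall>n\<ge>N. measure (push (M n)) K \<le> \<pi> (1 / real m) + \<epsilon>)" by blast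
qed

text \<open>Applying \<open>h\<close> to every coordinate carries the product measure to the product
  of the image measures, and injectivity of \<open>h\<close> preserves the event that the commutator
  is trivial.\<close>

lemma dc_push:
  assumes \<mu>: "prob_measure_on G \<mu>" and c: "countable (carrier G)"
  shows "dc H k (push \<mu>) = dc G k \<mu>"
proof -
  note \<nu> = prob_measure_on_push[OF \<mu>]
  have ps: "prob_space \<mu>" "prob_space (push \<mu>)" using \<mu> \<nu> by (auto simp: prob_measure_on_def)
  have meas: "h \<in> measurable \<mu> (push \<mu>)"
    using h_measurable[OF \<mu>] by (simp add: push_def)
  \<comment> \<open>\<open>push \<mu>\<close> has the same measurable sets as the
    \<open>count_space\<close> in its definition, so it can be the target of its own image measure,
    as the product rule requires.\<close>
  have "distr \<mu> (push \<mu>) h = push \<mu>" unfolding push_def by (rule distr_cong) simp_all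
  hence eq: "distr (\<Pi>\<^sub>M i\<in>{..k}. \<mu>) (\<Pi>\<^sub>M i\<in>{..k}. push \<mu>) (compose {..k} h) = (\<Pi>\<^sub>M i\<in>{..k}. push \<mu>)"
    using distr_PiM_finite_prob_space'[of "{..k}" "\<lambda>_. \<mu>" "\<lambda>_. push \<mu>" h] ps meas by simp
  have sp: "space \<mu> = carrier G" "space (push \<mu>) = carrier H"
    and st: "sets \<mu> = Pow (carrier G)" "sets (push \<mu>) = Pow (carrier H)"
    using \<mu> \<nu> by (auto simp: prob_measure_on_def)
  have cH: "countable (carrier H)" using c image_carrier by (metis countable_image)
  have sets: "sets (\<Pi>\<^sub>M i\<in>{..k}. \<mu>) = Pow ({..k} \<rightarrow>\<^sub>E carrier G)"
    "sets (\<Pi>\<^sub>M i\<in>{..k}. push \<mu>) = Pow ({..k} \<rightarrow>\<^sub>E carrier H)"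
    using sets_PiM_countable[OF finite_atMost c st(1)] sets_PiM_countable[OF finite_atMost cH st(2)]
    by auto
  have comp: "compose {..k} h x \<in> ({..k} \<rightarrow>\<^sub>E carrier H)" if "x \<in> ({..k} \<rightarrow>\<^sub>E carrier G)" for x
    using that by (auto simp: compose_def PiE_iff)
  have cm: "compose {..k} h \<in> measurable (\<Pi>\<^sub>M i\<in>{..k}. \<mu>) (\<Pi>\<^sub>M i\<in>{..k}. push \<mu>)"
    by (rule measurableI) (use comp in \<open>auto simp: space_PiM sp sets\<close>)
  let ?A = "{x \<in> {..k} \<rightarrow>\<^sub>E carrier H. simple_comm H x k = \<one>\<^bsub>H\<^esub>}"
  have iff: "simple_comm H (compose {..k} h x) k = \<one>\<^bsub>H\<^esub> \<longleftrightarrow> simple_comm G x k = \<one>\<^bsub>G\<^esub>"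
    if x: "x \<in> ({..k} \<rightarrow>\<^sub>E carrier G)" for x
  proof -
    have xG: "x i \<in> carrier G" if "i \<le> k" for i using x that by (simp add: PiE_iff)
    have "simple_comm H (compose {..k} h x) k = simple_comm H (\<lambda>i. h (x i)) k"
      by (rule simple_comm_cong) (simp add: compose_def)
    also have "\<dots> = h (simple_comm G x k)" by (rule simple_comm_hom[OF xG])
    finally show ?thesis using h_eq_one_iff[OF G.simple_comm_closed[OF xG]] by (simp only:)
  qed
  have "dc H k (push \<mu>) = measure (distr (\<Pi>\<^sub>M i\<in>{..k}. \<mu>) (\<Pi>\<^sub>M i\<in>{..k}. push \<mu>) (compose {..k} h)) ?A"
    by (simp only: eq dc_def)
  also have "\<dots> = measure (\<Pi>\<^sub>M i\<in>{..k}. \<mu>) (compose {..k} h -` ?A \<inter> space (\<Pi>\<^sub>M i\<in>{..k}. \<mu>))"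
    by (rule measure_distr[OF cm]) (auto simp: sets)
  also have "compose {..k} h -` ?A \<inter> space (\<Pi>\<^sub>M i\<in>{..k}. \<mu>)
      = {x \<in> {..k} \<rightarrow>\<^sub>E carrier G. simple_comm G x k = \<one>\<^bsub>G\<^esub>}"
    using comp iff by (auto simp: space_PiM sp simp del: PiE_iff)
  finally show ?thesis by (simp only: dc_def)
qed

lemma step_nilpotent_preimage:
  assumes K: "subgroup K H" and nil: "step_nilpotent (H\<lparr>carrier := K\<rparr>) k"
  shows "step_nilpotent (G\<lparr>carrier := {x \<in> carrier G. h x \<in> K}\<rparr>) k"
  unfolding step_nilpotent_def
proof (intro allI impI)
  let ?P = "{x \<in> carrier G. h x \<in> K}"
  fix x assume "\<forall>i\<le>k. x i \<in> carrier (G\<lparr>carrier := ?P\<rparr>)"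
  hence x: "x i \<in> ?P" if "i \<le> k" for i using that by simp
  hence xG: "x i \<in> carrier G" if "i \<le> k" for i using that by simp
  have hx: "h (x i) \<in> K" if "i \<le> k" for i using x that by simp
  have "h (simple_comm G x k) = simple_comm H (\<lambda>i. h (x i)) k"
    by (rule simple_comm_hom[OF xG, symmetric])
  also have "\<dots> = simple_comm (H\<lparr>carrier := K\<rparr>) (\<lambda>i. h (x i)) k"
    using H.simple_comm_subgroup[OF K, of k "\<lambda>i. h (x i)"] hx by simp
  also have "\<dots> = \<one>\<^bsub>H\<^esub>" using nil hx unfolding step_nilpotent_def by simp
  finally have "simple_comm G x k = \<one>\<^bsub>G\<^esub>"
    using h_eq_one_iff[OF G.simple_comm_closed[OF xG]] by (simp only:)
  thus "simple_comm (G\<lparr>carrier := ?P\<rparr>) x k = \<one>\<^bsub>G\<lparr>carrier := ?P\<rparr>\<^esub>"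
    using G.simple_comm_subgroup[OF subgroup_preimage[OF K] x] by simp
qed

end

lemma (in group) group_iso_image_group:
  assumes inj: "inj_on f (carrier G)"
  shows "group_iso G (image_group f G) f"
  using inj_imp_image_group_iso[OF inj] inj_imp_image_group_is_group[OF inj] is_group
  by (simp add: group_iso_def group_iso_axioms_def group_hom_def group_hom_axioms_def iso_def)

text \<open>A finitely generated group is countable, hence isomorphic to one on natural numbers. The
  subgroup found there is pulled back with its index unchanged, so the same \<open>C\<close>
  works.\<close>

lemma nilpotent_index_bound_nat_imp:
  assumes C: "nilpotent_index_bound TYPE(nat) r k \<pi> \<alpha> C"
  shows "nilpotent_index_bound TYPE('a) r k \<pi> \<alpha> C"
  unfolding nilpotent_index_bound_def
proof (intro allI impI, elim conjE)
  fix G :: "'a monoid" and M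
  assume G: "group G" and r: "rank_at_most G r" and M: "\<forall>n. prob_measure_on G (M n)"
    and det: "detects_index_uniformly G M \<pi>" and dc: "ereal \<alpha> \<le> dc_seq G k M"
  have c: "countable (carrier G)" by (rule group.countable_carrier[OF G r])
  define f where "f = to_nat_on (carrier G)"
  define G' where "G' = image_group f G"
  interpret group_iso G G' f
    unfolding G'_def f_def by (rule group.group_iso_image_group[OF G inj_on_to_nat_on[OF c]])
  have "dc_seq G' k (\<lambda>n. push (M n)) = dc_seq G k M"
    using dc_push[OF _ c] M by (simp add: dc_seq_def)
  hence "group G' \<and> rank_at_most G' r \<and> (\<forall>n. prob_measure_on G' (push (M n))) \<and>
      detects_index_uniformly G' (\<lambda>n. push (M n)) \<pi> \<and> ereal \<alpha> \<le> dc_seq G' k (\<lambda>n. push (M n))"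
    using H.is_group rank_at_most_image[OF r] prob_measure_on_push M dc
      detects_index_push[OF _ det] by simp
  hence "\<exists>K. subgroup K G' \<and> step_nilpotent (G'\<lparr>carrier := K\<rparr>) k \<and> subgroup_index G' K \<le> enat C"
    by (rule C[unfolded nilpotent_index_bound_def, rule_format])
  then obtain K where K: "subgroup K G'" "step_nilpotent (G'\<lparr>carrier := K\<rparr>) k"
    "subgroup_index G' K \<le> enat C" by blast
  show "\<exists>K. subgroup K G \<and> step_nilpotent (G\<lparr>carrier := K\<rparr>) k \<and> subgroup_index G K \<le> enat C"
    using subgroup_preimage[OF K(1)] step_nilpotent_preimage[OF K(1,2)]
      subgroup_index_preimage[OF K(1) image_carrier] K(3) by metis
qed

theorem theorem1p5:
  fixes r k :: nat and \<alpha> :: real and \<pi> :: "real \<Rightarrow> real"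
  assumes "\<alpha> > 0"
    and "\<forall>\<gamma>\<in>{0<..1}. \<pi> \<gamma> \<in> {0<..1}"
    and "mono_on {0<..1} \<pi>"
    and "(\<pi> \<longlongrightarrow> 0) (at_right 0)"
  shows "(\<exists>C. nilpotent_index_bound TYPE(nat) r k \<pi> \<alpha> C) \<and>
    (\<forall>C. nilpotent_index_bound TYPE(nat) r k \<pi> \<alpha> C \<longrightarrow>
         nilpotent_index_bound TYPE('a) r k \<pi> \<alpha> C)"
  using nilpotent_index_bound_exists[OF assms(1,4)] nilpotent_index_bound_nat_imp by blast

end
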